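(* Let $G$ be a $2$-connected graph such that $\sigma_2(G) \ge 2\tilde{\alpha}(G) - 1$. Then $G$ is Hamiltonian.
   Context: All graphs are finite and simple. For a graph $G$, $\sigma_2(G) = \min\{d(x)+d(y) : x,y \text{ distinct, nonadjacent vertices of } G\}$, where $d$ denotes degree. For positive integers $s,t$, an $(s,t)$-bipartite-hole of $G$ is a pair of disjoint vertex sets $S,T$ with $|S|=s$, $|T|=t$ and no edge of $G$ between $S$ and $T$. The bipartite-hole-number $\tilde{\alpha}(G)$ is the minimum integer $k$ such that there exist positive integers $s,t$ with $s+t=k+1$ for which $G$ contains no $(s,t)$-bipartite-hole. A graph is Hamiltonian if it contains a cycle through all of its vertices. *)

theory Defs
  imports "Graph_Theory.Graph_Theory" "HOL-Library.Extended_Nat"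
begin

text \<open>
  A finite simple graph is a \<^locale>\<open>pair_graph\<close>: a finite vertex set with a symmetric and
  irreflexive arc relation. Each undirected edge is a pair of opposite arcs, so the degree of a
  vertex is its out-degree. The empty graph is allowed here; it is not 2-connected.
\<close>

definition degree :: "'a pair_pre_digraph \<Rightarrow> 'a \<Rightarrow> nat" where
  "degree G v = out_degree (with_proj G) v"

text \<open>A complete graph has no pair of distinct nonadjacent vertices; the minimum over the empty
  set is read as \<open>\<infinity>\<close>.\<close>

definition sigma2 :: "'a pair_pre_digraph \<Rightarrow> enat" where
  "sigma2 G = Inf {enat (degree G x + degree G y) | x y.
     x \<in> pverts G \<and> y \<in> pverts G \<and> x \<noteq> y \<and> (x, y) \<notin> parcs G}"

definition bipartite_hole :: "'a pair_pre_digraph \<Rightarrow> nat \<Rightarrow> nat \<Rightarrow> 'a set \<Rightarrow> 'a set \<Rightarrow> bool" where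
  "bipartite_hole G s t S T \<longleftrightarrow>
     S \<subseteq> pverts G \<and> T \<subseteq> pverts G \<and> S \<inter> T = {} \<and> card S = s \<and> card T = t \<and>
     (\<forall>x\<in>S. \<forall>y\<in>T. (x, y) \<notin> parcs G)"

definition bipartite_hole_number :: "'a pair_pre_digraph \<Rightarrow> nat" where
  "bipartite_hole_number G =
     (LEAST k. \<exists>s t. 0 < s \<and> 0 < t \<and> s + t = k + 1 \<and> \<not> (\<exists>S T. bipartite_hole G s t S T))"

text \<open>For finite graphs the minimum exists, and it is positive, so that the truncated difference
  \<open>2 * bipartite_hole_number G - 1\<close> on the natural numbers is the true difference.\<close>

lemma bipartite_hole_number_attained:
  assumes "finite (pverts G)"
  shows "\<exists>s t. 0 < s \<and> 0 < t \<and> s + t = bipartite_hole_number G + 1 \<and>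
           \<not> (\<exists>S T. bipartite_hole G s t S T)"
  unfolding bipartite_hole_number_def
proof (rule LeastI_ex)
  let ?s = "Suc (card (pverts G))"
  have "\<not> (\<exists>S T. bipartite_hole G ?s 1 S T)"
    unfolding bipartite_hole_def using card_mono[OF assms] by fastforce
  then show "\<exists>k s t. 0 < s \<and> 0 < t \<and> s + t = k + 1 \<and> \<not> (\<exists>S T. bipartite_hole G s t S T)"
    by (intro exI[of _ ?s] exI[of _ 1]) simp
qed

lemma bipartite_hole_number_pos:
  assumes "finite (pverts G)"
  shows "0 < bipartite_hole_number G"
  using bipartite_hole_number_attained[OF assms] by fastforce

definition k_connected :: "nat \<Rightarrow> 'a pair_pre_digraph \<Rightarrow> bool" where
  "k_connected k G \<longleftrightarrow> k < card (pverts G) \<and>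
     (\<forall>X. X \<subseteq> pverts G \<and> card X < k \<longrightarrow> connected (with_proj G \<restriction> (pverts G - X)))"

text \<open>In a symmetric digraph, \<^const>\<open>pre_digraph.cycle\<close> also admits the walk that traverses
  one edge back and forth; the bound on the length excludes it.\<close>

definition hamiltonian :: "'a pair_pre_digraph \<Rightarrow> bool" where
  "hamiltonian G \<longleftrightarrow> (\<exists>u p. pre_digraph.awalk (with_proj G) u p u \<and>
     pre_digraph.cycle (with_proj G) p \<and> 3 \<le> length p \<and>
     set (pre_digraph.awalk_verts (with_proj G) u p) = pverts G)"

end

theory Submission
  imports Defs
begin

text \<open>
  Let \<open>k = s + t - 1\<close> be the bipartite-hole-number, attained by \<open>s\<close> and \<open>t\<close>. All hypotheses survive
  the addition of edges, so by induction on the number of non-edges the endpoints of any missing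
  edge are joined by a Hamiltonian path. If two nonadjacent vertices both have degree at least \<open>k\<close>,
  the McDiarmid--Yolov argument applies to this path: the shifted neighbourhoods of its two ends
  contain disjoint sets of sizes \<open>s\<close> and \<open>t\<close>, and an edge between them closes a Hamiltonian cycle.
  Otherwise the vertices of degree at least \<open>k\<close> form a clique, and so do the others, since two
  nonadjacent ones would have degree sum at most \<open>2 * k - 2\<close>. Two cliques covering a 2-connected
  graph are joined by two disjoint edges, which yield a Hamiltonian cycle.
\<close>

section \<open>Hamiltonian cycles as vertex lists\<close>

abbreviation adj_path :: "('a \<times> 'a) set \<Rightarrow> 'a list \<Rightarrow> bool" where
  "adj_path E \<equiv> successively (\<lambda>x y. (x, y) \<in> E)"

definition ham_path :: "('a \<times> 'a) set \<Rightarrow> 'a set \<Rightarrow> 'a list \<Rightarrow> bool" where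
  "ham_path E V xs \<longleftrightarrow> distinct xs \<and> set xs = V \<and> adj_path E xs"

definition ham_cycle :: "('a \<times> 'a) set \<Rightarrow> 'a set \<Rightarrow> 'a list \<Rightarrow> bool" where
  "ham_cycle E V xs \<longleftrightarrow> ham_path E V xs \<and> 3 \<le> length xs \<and> (last xs, hd xs) \<in> E"

lemma adj_path_rev:
  assumes "sym E"
  shows "adj_path E (rev xs) \<longleftrightarrow> adj_path E xs"
proof -
  have "(\<lambda>x y. (y, x) \<in> E) = (\<lambda>x y. (x, y) \<in> E)"
    using assms by (auto simp: sym_def fun_eq_iff)
  then show ?thesis by (simp only: successively_rev)
qed

text \<open>The two path edges linking \<open>a\<close>, \<open>b\<close> and \<open>c\<close> are
  dropped. The first two new edges join the reoriented pieces, and the edge from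
  \<open>last a\<close> to \<open>hd c\<close> closes the cycle.\<close>

lemma ham_cycle_exchange_parallel:
  assumes "sym E" "ham_path E V (a @ b @ c)" "a \<noteq> []" "b \<noteq> []" "c \<noteq> []"
    and "(hd a, hd b) \<in> E" "(last b, last c) \<in> E" "(last a, hd c) \<in> E"
  shows "ham_cycle E V (rev a @ b @ rev c)"
proof -
  have "1 \<le> length a" "1 \<le> length b" "1 \<le> length c"
    using assms by (simp_all add: Suc_le_eq)
  then have "3 \<le> length (rev a @ b @ rev c)" by simp
  then show ?thesis
    using assms by (auto simp: ham_cycle_def ham_path_def successively_append_iff adj_path_rev[OF \<open>sym E\<close>]
        hd_rev last_rev hd_append last_append dest: symD simp del: successively_rev)
qed

text \<open>Here the pieces are also reordered: \<open>hd a\<close> leads to \<open>hd c\<close>,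
  \<open>last c\<close> leads to \<open>hd b\<close>, and the edge from \<open>last b\<close> to
  \<open>last a\<close> closes the cycle.\<close>

lemma ham_cycle_exchange_crossed:
  assumes "sym E" "ham_path E V (a @ b @ c)" "a \<noteq> []" "b \<noteq> []" "c \<noteq> []"
    and "(hd a, hd c) \<in> E" "(last c, hd b) \<in> E" "(last b, last a) \<in> E"
  shows "ham_cycle E V (rev a @ c @ b)"
proof -
  have "1 \<le> length a" "1 \<le> length b" "1 \<le> length c"
    using assms by (simp_all add: Suc_le_eq)
  then have "3 \<le> length (rev a @ c @ b)" by simp
  then show ?thesis
    using assms by (auto simp: ham_cycle_def ham_path_def successively_append_iff adj_path_rev[OF \<open>sym E\<close>]
        hd_rev last_rev hd_append last_append dest: symD simp del: successively_rev)
qed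

text \<open>Otherwise the parallel exchange applies, \<open>b\<close> being the segment from
  position \<open>i\<close> to position \<open>j\<close> inclusive. The chord leaves the predecessor
  of a neighbour of the first vertex and reaches the successor of a neighbour of the last.\<close>

lemma no_parallel_chord:
  assumes "sym E" "ham_path E V xs" "\<nexists>ys. ham_cycle E V ys"
    and "0 < i" "i \<le> j" "Suc j < length xs"
    and "(hd xs, xs ! i) \<in> E" "(last xs, xs ! j) \<in> E"
  shows "(xs ! (i - 1), xs ! Suc j) \<notin> E"
proof
  assume e: "(xs ! (i - 1), xs ! Suc j) \<in> E"
  define a b c where "a = take i xs" and "b = take (Suc j - i) (drop i xs)" and "c = drop (Suc j) xs"
  have abc: "xs = a @ b @ c"
    using assms(5) unfolding a_def b_def c_def
    by (metis add_diff_inverse_nat append_take_drop_id drop_drop le_imp_less_Suc less_imp_not_less add.commute)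
  have "a \<noteq> []" "b \<noteq> []" "c \<noteq> []"
    using assms(4-6) by (auto simp: a_def b_def c_def)
  moreover have "Suc (length xs - 2) = length xs - 1" using assms(6) by simp
  moreover have "hd a = hd xs" "last c = last xs" "hd b = xs ! i" "last b = xs ! j"
      "last a = xs ! (i - 1)" "hd c = xs ! Suc j"
    using assms(4-6) calculation
    by (auto simp: a_def b_def c_def hd_drop_conv_nth hd_take last_conv_nth)
  ultimately have "ham_cycle E V (rev a @ b @ rev c)"
    using assms(1,2,7,8) e abc
    by (intro ham_cycle_exchange_parallel) (auto simp del: append_assoc dest: symD)
  then show False using assms(3) by blast
qed

text \<open>Otherwise the crossed exchange applies to the path cut just before the positions
  \<open>j\<close> and \<open>i\<close>; now both ends of the chord are predecessors.\<close>

lemma no_crossed_chord: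
  assumes "sym E" "ham_path E V xs" "\<nexists>ys. ham_cycle E V ys"
    and "0 < j" "j < i" "i < length xs"
    and "(hd xs, xs ! i) \<in> E" "(last xs, xs ! j) \<in> E"
  shows "(xs ! (j - 1), xs ! (i - 1)) \<notin> E"
proof
  assume e: "(xs ! (j - 1), xs ! (i - 1)) \<in> E"
  define a b c where "a = take j xs" and "b = take (i - j) (drop j xs)" and "c = drop i xs"
  have abc: "xs = a @ b @ c"
    using assms(5) unfolding a_def b_def c_def
    by (metis add_diff_inverse_nat append_take_drop_id drop_drop less_imp_not_less add.commute)
  have "a \<noteq> []" "b \<noteq> []" "c \<noteq> []"
    using assms(4-6) by (auto simp: a_def b_def c_def)
  moreover have "hd a = hd xs" "last c = last xs" "hd b = xs ! j" "last b = xs ! (i - 1)"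
      "last a = xs ! (j - 1)" "hd c = xs ! i"
    using assms(4-6) calculation
    by (auto simp: a_def b_def c_def hd_drop_conv_nth hd_take last_conv_nth)
  ultimately have "ham_cycle E V (rev a @ c @ b)"
    using assms(1,2,7,8) e abc
    by (intro ham_cycle_exchange_crossed) (auto simp del: append_assoc dest: symD)
  then show False using assms(3) by blast
qed

section \<open>The bipartite-hole argument\<close>

text \<open>Lower bounds replace the exact sizes of a bipartite hole, so that sets with merely
  enough elements can be used directly.\<close>

definition hole_free :: "('a \<times> 'a) set \<Rightarrow> 'a set \<Rightarrow> nat \<Rightarrow> nat \<Rightarrow> bool" where
  "hole_free E V s t \<longleftrightarrow> (\<forall>S T. S \<subseteq> V \<and> T \<subseteq> V \<and> S \<inter> T = {} \<and> s \<le> card S \<and> t \<le> card T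
     \<longrightarrow> (\<exists>x\<in>S. \<exists>y\<in>T. (x, y) \<in> E))"

text \<open>Positions in a distinct list correspond injectively to vertices, so disjointness and
  sizes can be checked on index sets.\<close>

lemma hole_freeE:
  assumes "hole_free E (set xs) s t" "distinct xs"
    and "A \<subseteq> {..<length xs}" "B \<subseteq> {..<length xs}" "A \<inter> B = {}" "s \<le> card A" "t \<le> card B"
  obtains a b where "a \<in> A" "b \<in> B" "(xs ! a, xs ! b) \<in> E"
proof -
  have inj: "inj_on ((!) xs) {..<length xs}"
    using assms(2) by (auto simp: inj_on_def nth_eq_iff_index_eq)
  have "card ((!) xs ` A) = card A" "card ((!) xs ` B) = card B"
    using inj assms(3,4) by (auto intro!: card_image intro: inj_on_subset)
  moreover have "(!) xs ` A \<inter> (!) xs ` B = {}"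
    using inj_on_image_Int[OF inj assms(3,4)] assms(5) by simp
  moreover have "(!) xs ` A \<subseteq> set xs" "(!) xs ` B \<subseteq> set xs"
    using assms(3,4) by auto
  ultimately have "\<exists>x\<in>(!) xs ` A. \<exists>y\<in>(!) xs ` B. (x, y) \<in> E"
    using assms(1,6,7) unfolding hole_free_def by metis
  then show thesis using that by blast
qed

lemma card_neighbour_indices:
  assumes "distinct xs" "E `` {x} \<subseteq> set xs"
  shows "card {i. i < length xs \<and> (x, xs ! i) \<in> E} = card (E `` {x})"
proof -
  have "(!) xs ` {i. i < length xs \<and> (x, xs ! i) \<in> E} = E `` {x}"
    using assms(2) by (fastforce simp: in_set_conv_nth image_iff)
  moreover have "inj_on ((!) xs) {i. i < length xs \<and> (x, xs ! i) \<in> E}"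
    using assms(1) by (auto simp: inj_on_def nth_eq_iff_index_eq)
  ultimately show ?thesis using card_image by fastforce
qed

text \<open>This selects the \<open>s\<close>-th smallest element. The induction on the rank passes
  from \<open>r\<close> to the least element above it.\<close>

lemma split_at_rank:
  fixes I :: "nat set"
  assumes "finite I" "0 < s" "s \<le> card I"
  obtains r where "r \<in> I" "card {i \<in> I. i < r} = s - 1"
proof -
  have "\<exists>r\<in>I. card {i \<in> I. i < r} = k" if "k < card I" for k
    using that
  proof (induction k)
    case 0
    then have "I \<noteq> {}" by auto
    then have "Min I \<in> I" "{i \<in> I. i < Min I} = {}" using assms(1) by auto
    then show ?case by (intro bexI[of _ "Min I"]) simp_all
  next
    case (Suc k)
    then obtain r where r: "r \<in> I" "card {i \<in> I. i < r} = k" by auto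
    define r' where "r' = Min {i \<in> I. r < i}"
    have le: "{i \<in> I. i \<le> r} = insert r {i \<in> I. i < r}" using r(1) by auto
    then have c: "card {i \<in> I. i \<le> r} = Suc k" using r(2) assms(1) by simp
    have "{i \<in> I. r < i} \<noteq> {}"
    proof
      assume "{i \<in> I. r < i} = {}"
      then have "{i \<in> I. i \<le> r} = I" by (auto simp: not_less)
      then show False using c Suc.prems by simp
    qed
    then have r': "r' \<in> {i \<in> I. r < i}" unfolding r'_def using assms(1) by (intro Min_in) auto
    have "r' \<le> i" if "i \<in> I" "r < i" for i unfolding r'_def using assms(1) that by (intro Min_le) auto
    then have "{i \<in> I. i < r'} = {i \<in> I. i \<le> r}" using r' by (auto simp: not_le[symmetric])
    then show ?case using c r' by (intro bexI[of _ r']) auto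
  qed
  moreover have "s - 1 < card I" using assms(2,3) by linarith
  ultimately obtain r where "r \<in> I" "card {i \<in> I. i < r} = s - 1"
    by blast
  then show thesis by (rule that)
qed

text \<open>Each end has at least \<open>s + t - 1\<close> neighbours. This leaves enough shifted
  neighbour positions for two disjoint sets of sizes at least \<open>s\<close> and \<open>t\<close>;
  an edge between them is a chord that one of the two exchanges turns into a cycle.\<close>

lemma ham_path_closes:
  assumes "finite V" "sym E" "irrefl E" "E \<subseteq> V \<times> V"
    and path: "ham_path E V xs" "(hd xs, last xs) \<notin> E"
    and "0 < s" "0 < t" "hole_free E V s t"
    and deg: "s + t \<le> card (E `` {hd xs}) + 1" "s + t \<le> card (E `` {last xs}) + 1"
  shows "\<exists>ys. ham_cycle E V ys"
proof (rule ccontr)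
  assume no: "\<nexists>ys. ham_cycle E V ys"
  define n where "n = length xs"
  define I where "I = {i. i < n \<and> (hd xs, xs ! i) \<in> E}"
  define J where "J = {j. j < n \<and> (last xs, xs ! j) \<in> E}"
  have xs: "distinct xs" "set xs = V" using path by (auto simp: ham_path_def)
  have "\<And>x. E `` {x} \<subseteq> set xs" using xs(2) \<open>E \<subseteq> V \<times> V\<close> by auto
  then have cards: "s + t \<le> card I + 1" "s + t \<le> card J + 1"
    using deg unfolding I_def J_def n_def by (simp_all only: card_neighbour_indices[OF xs(1)])
  have fin: "finite I" "finite J" by (auto simp: I_def J_def)
  have free: "hole_free E (set xs) s t" using assms(9) xs by simp
  have "I \<noteq> {}" using cards assms(7,8) by auto
  then have "xs \<noteq> []" by (auto simp: I_def n_def)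
  \<comment> \<open>Shifted positions must stay on the path. Irreflexivity keeps \<open>0\<close>
    out of \<open>I\<close> and \<open>n - 1\<close> out of \<open>J\<close>; nonadjacency of the
    ends keeps \<open>0\<close> out of \<open>J\<close>.\<close>
  have I0: "0 < i" if "i \<in> I" for i
    using that \<open>irrefl E\<close> \<open>xs \<noteq> []\<close> by (cases i) (auto simp: I_def irrefl_def hd_conv_nth)
  have Jn: "Suc j < n" if "j \<in> J" for j
  proof -
    have "j \<noteq> n - 1" "j < n"
      using that \<open>irrefl E\<close> \<open>xs \<noteq> []\<close> by (auto simp: J_def n_def irrefl_def last_conv_nth)
    then show ?thesis by simp
  qed
  have J0: "0 < j" if "j \<in> J" for j
    using that path(2) \<open>sym E\<close> \<open>xs \<noteq> []\<close>
    by (cases j) (auto simp: J_def hd_conv_nth dest: symD)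
  have "s \<le> card I" using cards(1) \<open>0 < t\<close> by linarith
  \<comment> \<open>Split the path at the \<open>s\<close>-th neighbour of its first vertex: parallel chords give a contradiction
    if the last vertex has \<open>t\<close> neighbours from there on, and crossed chords do otherwise.\<close>
  then obtain r where r: "r \<in> I" "card {i \<in> I. i < r} = s - 1"
    using split_at_rank[OF fin(1) \<open>0 < s\<close>] by blast
  have pred: "inj_on (\<lambda>i. i - 1) A" if "A \<subseteq> I \<or> A \<subseteq> J" for A :: "nat set"
  proof (rule inj_onI)
    fix i j assume "i \<in> A" "j \<in> A" "i - 1 = j - 1"
    moreover from this have "0 < i" "0 < j" using that I0 J0 by blast+
    ultimately show "i = j" by linarith
  qed
  show False
  proof (cases "t \<le> card {j \<in> J. r \<le> j}")
    case True
    \<comment> \<open>Including \<open>r\<close> itself gives \<open>?A\<close> exactly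
      \<open>s\<close> elements. They lie below \<open>r\<close> and those of \<open>?B\<close>
      above it.\<close>
    let ?A = "(\<lambda>i. i - 1) ` {i \<in> I. i \<le> r}" and ?B = "Suc ` {j \<in> J. r \<le> j}"
    have "{i \<in> I. i \<le> r} = insert r {i \<in> I. i < r}" using r(1) by auto
    then have "card {i \<in> I. i \<le> r} = s" using r(2) fin \<open>0 < s\<close> by simp
    then have "s \<le> card ?A" by (subst card_image, intro pred) auto
    moreover have "t \<le> card ?B" using True by (simp add: card_image)
    moreover have "?A \<subseteq> {..<length xs}" by (auto simp: I_def n_def)
    moreover have "?B \<subseteq> {..<length xs}" using Jn by (auto simp: n_def)
    moreover have "?A \<inter> ?B = {}" by auto
    ultimately obtain a b where "a \<in> ?A" "b \<in> ?B" "(xs ! a, xs ! b) \<in> E"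
      by (elim hole_freeE[OF free xs(1), rotated -1])
    then obtain i j where "i \<in> I" "i \<le> r" "j \<in> J" "r \<le> j" "(xs ! (i - 1), xs ! Suc j) \<in> E"
      by blast
    then show False
      using no_parallel_chord[OF \<open>sym E\<close> path(1) no, of i j] I0 Jn by (auto simp: I_def J_def n_def)
  next
    case False
    \<comment> \<open>Fewer than \<open>t\<close> elements of \<open>J\<close> are at least
      \<open>r\<close>, so at least \<open>s\<close> are below; only \<open>s - 1\<close> elements
      of \<open>I\<close> are below \<open>r\<close>, so at least \<open>t\<close> remain.
      Positivity on \<open>J\<close> prevents a collision at the truncated value
      \<open>0 - 1 = 0\<close>.\<close>
    let ?A = "(\<lambda>j. j - 1) ` {j \<in> J. j < r}" and ?B = "(\<lambda>i. i - 1) ` {i \<in> I. r \<le> i}"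
    have "card I = card {i \<in> I. i < r} + card {i \<in> I. r \<le> i}"
      using fin by (subst card_Un_disjoint[symmetric]) (auto intro!: arg_cong[of _ _ card])
    then have "t \<le> card {i \<in> I. r \<le> i}" using cards(1) r(2) \<open>0 < s\<close> by simp
    then have "t \<le> card ?B" by (subst card_image, intro pred) auto
    moreover have "card J = card {j \<in> J. j < r} + card {j \<in> J. r \<le> j}"
      using fin by (subst card_Un_disjoint[symmetric]) (auto intro!: arg_cong[of _ _ card])
    then have "s \<le> card {j \<in> J. j < r}" using cards(2) False by simp
    then have "s \<le> card ?A" by (subst card_image, intro pred) auto
    moreover have "?A \<subseteq> {..<length xs}" "?B \<subseteq> {..<length xs}" by (auto simp: I_def J_def n_def)
    moreover have "?A \<inter> ?B = {}" using J0 by fastforce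
    ultimately obtain a b where "a \<in> ?A" "b \<in> ?B" "(xs ! a, xs ! b) \<in> E"
      by (elim hole_freeE[OF free xs(1), rotated -1])
    then obtain i j where "j \<in> J" "j < r" "i \<in> I" "r \<le> i" "(xs ! (j - 1), xs ! (i - 1)) \<in> E"
      by blast
    then show False
      using no_crossed_chord[OF \<open>sym E\<close> path(1) no, of j i] J0 by (auto simp: I_def J_def n_def)
  qed
qed

section \<open>Two cliques\<close>

lemma adj_path_clique:
  assumes "\<And>x y. x \<in> set xs \<Longrightarrow> y \<in> set xs \<Longrightarrow> x \<noteq> y \<Longrightarrow> (x, y) \<in> E" "distinct xs"
  shows "adj_path E xs"
  using assms by (induction xs rule: induct_list012) auto

text \<open>Any ordering of a clique is a path, so both ends can be prescribed; they may coincide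
  only when the clique is a single vertex.\<close>

lemma clique_path:
  assumes "finite L" "\<And>x y. x \<in> L \<Longrightarrow> y \<in> L \<Longrightarrow> x \<noteq> y \<Longrightarrow> (x, y) \<in> E"
    and "u \<in> L" "v \<in> L" "u \<noteq> v \<or> L = {u}"
  obtains xs where "ham_path E L xs" "xs \<noteq> []" "hd xs = u" "last xs = v"
proof (cases "u = v")
  case True
  then show thesis using assms that[of "[u]"] by (auto simp: ham_path_def)
next
  case False
  obtain ms where ms: "set ms = L - {u, v}" "distinct ms"
    using assms(1) by (meson finite_Diff finite_distinct_list)
  let ?xs = "u # ms @ [v]"
  have "distinct ?xs" "set ?xs = L" using ms assms False by auto
  moreover from this have "adj_path E ?xs" using assms(2) by (intro adj_path_clique) auto
  ultimately show thesis using that[of ?xs] by (simp add: ham_path_def)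
qed

text \<open>2-connectivity in terms of cuts, a form visibly monotone in the edge set.\<close>

definition two_connected :: "('a \<times> 'a) set \<Rightarrow> 'a set \<Rightarrow> bool" where
  "two_connected E V \<longleftrightarrow> 2 < card V \<and>
     (\<forall>X A B. X \<union> A \<union> B = V \<and> card X < 2 \<and> X \<inter> A = {} \<and> X \<inter> B = {} \<and> A \<inter> B = {} \<and> A \<noteq> {} \<and> B \<noteq> {}
        \<longrightarrow> (\<exists>a\<in>A. \<exists>b\<in>B. (a, b) \<in> E))"

lemma two_connected_cut:
  assumes "two_connected E V" "X \<union> A \<union> B = V" "card X < 2" "X \<inter> A = {}" "X \<inter> B = {}" "A \<inter> B = {}"
    "A \<noteq> {}" "B \<noteq> {}"
  obtains a b where "a \<in> A" "b \<in> B" "(a, b) \<in> E"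
proof -
  have "\<exists>a\<in>A. \<exists>b\<in>B. (a, b) \<in> E"
    using assms(1) unfolding two_connected_def
    by (elim conjE allE[of _ X] allE[of _ A] allE[of _ B] impE) (use assms(2-8) in auto)
  then show thesis using that by blast
qed

text \<open>Cutting at the empty set, at an end \<open>l\<close> and at an end \<open>h\<close>
  yields crossing edges, two of which can be chosen disjoint. Sharing an end is allowed only on a
  side with a single vertex.\<close>

lemma two_disjoint_edges:
  assumes conn: "two_connected E V" and V: "V = L \<union> H" "L \<inter> H = {}" "L \<noteq> {}" "H \<noteq> {}"
  obtains l h l' h' where "l \<in> L" "h \<in> H" "l' \<in> L" "h' \<in> H" "(l, h) \<in> E" "(l', h') \<in> E"
    "l \<noteq> l' \<or> L = {l}" "h \<noteq> h' \<or> H = {h}"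
proof -
  note edges = that
  obtain l h where lh: "l \<in> L" "h \<in> H" "(l, h) \<in> E"
    using V by (elim two_connected_cut[OF conn, of "{}" L H, rotated -1]) auto
  have remove_L: thesis if neq: "L \<noteq> {l}"
  proof -
    obtain l2 h2 where e2: "l2 \<in> L - {l}" "h2 \<in> H" "(l2, h2) \<in> E"
      using V lh neq by (elim two_connected_cut[OF conn, of "{l}" "L - {l}" H, rotated -1]) auto
    show thesis
    proof (cases "h2 \<noteq> h \<or> H = {h}")
      case True
      then show thesis using e2 lh by (intro edges[of l h l2 h2]) auto
    next
      case False
      \<comment> \<open>The second edge meets the first at \<open>h\<close>, so \<open>h\<close> is
        deleted instead. If the new edge starts at \<open>l\<close>, it is disjoint from the second
        edge; otherwise it is disjoint from the first.\<close>
      obtain l3 h3 where e3: "l3 \<in> L" "h3 \<in> H - {h}" "(l3, h3) \<in> E"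
        using V lh False by (elim two_connected_cut[OF conn, of "{h}" L "H - {h}", rotated -1]) auto
      show thesis
      proof (cases "l3 = l")
        case True
        then show thesis using e2 e3 False by (intro edges[of l2 h2 l3 h3]) auto
      next
        case False
        then show thesis using lh e3 by (intro edges[of l h l3 h3]) auto
      qed
    qed
  qed
  show thesis
  proof (cases "L = {l}")
    case False
    then show thesis by (rule remove_L)
  next
    case True
    show thesis
    proof (cases "H = {h}")
      case True
      then show thesis using \<open>L = {l}\<close> lh by (intro edges[of l h l h]) auto
    next
      case False
      obtain l2 h2 where e2: "l2 \<in> L" "h2 \<in> H - {h}" "(l2, h2) \<in> E"
        using V lh False by (elim two_connected_cut[OF conn, of "{h}" L "H - {h}", rotated -1]) auto
      then show thesis using lh True by (intro edges[of l h l2 h2]) auto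
    qed
  qed
qed

text \<open>One clique is traversed from \<open>l\<close> to \<open>l'\<close>, the other back from
  \<open>h'\<close> to \<open>h\<close>, with the two crossing edges as links. If one side is empty,
  the whole graph is a clique and any ordering works.\<close>

lemma ham_cycle_two_cliques:
  assumes conn: "two_connected E V" and "sym E" "finite V" "V = L \<union> H" "L \<inter> H = {}"
    and clique: "\<And>x y. x \<in> L \<Longrightarrow> y \<in> L \<Longrightarrow> x \<noteq> y \<Longrightarrow> (x, y) \<in> E"
      "\<And>x y. x \<in> H \<Longrightarrow> y \<in> H \<Longrightarrow> x \<noteq> y \<Longrightarrow> (x, y) \<in> E"
  shows "\<exists>xs. ham_cycle E V xs"
proof (cases "L = {} \<or> H = {}")
  case True
  then have V: "(x, y) \<in> E" if "x \<in> V" "y \<in> V" "x \<noteq> y" for x y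
    using that clique assms(4) by auto
  obtain xs where xs: "set xs = V" "distinct xs" using \<open>finite V\<close> finite_distinct_list by blast
  then have len: "3 \<le> length xs" using conn distinct_card[of xs] by (simp add: two_connected_def)
  then have "last xs \<noteq> hd xs"
    using xs(2) by (cases xs) auto
  moreover have "last xs \<in> set xs" "hd xs \<in> set xs" using len by (cases xs; simp)+
  moreover have "adj_path E xs" using adj_path_clique[OF _ xs(2)] V xs(1) by blast
  ultimately show ?thesis using len xs V unfolding ham_cycle_def ham_path_def by blast
next
  case False
  then obtain l h l' h' where e: "l \<in> L" "h \<in> H" "l' \<in> L" "h' \<in> H" "(l, h) \<in> E" "(l', h') \<in> E"
    "l \<noteq> l' \<or> L = {l}" "h \<noteq> h' \<or> H = {h}"
    using two_disjoint_edges[OF conn assms(4,5)] by blast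
  have fin: "finite L" "finite H" using assms by auto
  obtain as where as: "ham_path E L as" "as \<noteq> []" "hd as = l" "last as = l'"
    using clique_path[OF fin(1) clique(1) e(1,3,7)] by blast
  obtain bs where bs: "ham_path E H bs" "bs \<noteq> []" "hd bs = h" "last bs = h'"
    using clique_path[OF fin(2) clique(2) e(2,4,8)] by blast
  have path: "ham_path E V (as @ rev bs)"
    using as bs e assms(4,5) unfolding ham_path_def
    by (auto simp: successively_append_iff adj_path_rev[OF \<open>sym E\<close>] hd_rev simp del: successively_rev)
  moreover have "length (as @ rev bs) = card V"
    using path distinct_card[of "as @ rev bs"] unfolding ham_path_def by metis
  moreover have "(last (as @ rev bs), hd (as @ rev bs)) \<in> E"
    using as bs e \<open>sym E\<close> by (auto simp: last_rev dest: symD)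
  ultimately show ?thesis using conn unfolding ham_cycle_def two_connected_def by auto
qed

section \<open>The edge-closure induction\<close>

lemma ham_cycle_rotate:
  assumes "ham_cycle E V (a @ b)"
  shows "ham_cycle E V (b @ a)"
  using assms unfolding ham_cycle_def ham_path_def
  by (cases "a = []"; cases "b = []") (auto simp: successively_append_iff)

text \<open>If the cycle needs the added edge, a rotation makes that edge the closing one. The
  remaining path then lies in \<open>E\<close> and is reversed if its ends are in the wrong
  order.\<close>

lemma ham_cycle_remove_edge:
  assumes cyc: "ham_cycle (insert (u, v) (insert (v, u) E)) V xs" and "u \<noteq> v" "sym E"
  shows "(\<exists>ys. ham_cycle E V ys) \<or> (\<exists>ys. ham_path E V ys \<and> hd ys = u \<and> last ys = v)"
proof (cases "ham_cycle E V xs")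
  case True
  then show ?thesis by blast
next
  case False
  let ?E = "insert (u, v) (insert (v, u) E)"
  obtain ys where ys: "ham_cycle ?E V ys" "(last ys, hd ys) \<notin> E"
  proof (cases "(last xs, hd xs) \<in> E")
    case True
    then have "\<not> adj_path E xs" using cyc False by (auto simp: ham_cycle_def ham_path_def)
    then obtain i where i: "Suc i < length xs" "(xs ! i, xs ! Suc i) \<notin> E"
      by (auto simp: successively_conv_nth)
    have "ham_cycle ?E V (drop (Suc i) xs @ take (Suc i) xs)"
      by (rule ham_cycle_rotate) (simp only: append_take_drop_id cyc)
    moreover have "last (drop (Suc i) xs @ take (Suc i) xs) = xs ! i"
      "hd (drop (Suc i) xs @ take (Suc i) xs) = xs ! Suc i"
      using i by (auto simp: last_conv_nth hd_append hd_drop_conv_nth last_append)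
    ultimately show thesis using that i by metis
  next
    case False
    then show thesis using that cyc by blast
  qed
  have d: "distinct ys" "set ys = V" "adj_path ?E ys" "3 \<le> length ys" "(last ys, hd ys) \<in> ?E"
    using ys(1) by (auto simp: ham_cycle_def ham_path_def)
  have ends: "last ys = ys ! (length ys - 1)" "hd ys = ys ! 0"
    using d(4) by (cases "ys = []"; simp add: last_conv_nth hd_conv_nth)+
  have uv: "{last ys, hd ys} = {u, v}" using d(5) ys(2) by auto
  have "adj_path E ys"
    unfolding successively_conv_nth
  proof (intro allI impI)
    fix i assume i: "Suc i < length ys"
    show "(ys ! i, ys ! Suc i) \<in> E"
    proof (rule ccontr)
      assume "(ys ! i, ys ! Suc i) \<notin> E"
      moreover have "(ys ! i, ys ! Suc i) \<in> ?E" using d(3) i by (auto simp: successively_conv_nth)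
      \<comment> \<open>A second use of the new edge would make the first and last positions
        consecutive, which distinctness and length at least three forbid.\<close>
      ultimately have "{ys ! i, ys ! Suc i} = {ys ! (length ys - 1), ys ! 0}" using uv ends by auto
      moreover have "0 < length ys" "length ys - 1 < length ys" "i < length ys" using i by auto
      ultimately show False using i d(1,4) by (auto simp: doubleton_eq_iff nth_eq_iff_index_eq)
    qed
  qed
  then have "ham_path E V ys" "ham_path E V (rev ys)"
    using d \<open>sym E\<close> by (simp_all add: ham_path_def adj_path_rev del: successively_rev)
  moreover have "hd ys = u \<and> last ys = v \<or> hd (rev ys) = u \<and> last (rev ys) = v"
    using uv d(4) by (auto simp: doubleton_eq_iff hd_rev last_rev)
  ultimately show ?thesis by blast
qed

lemma hole_free_mono: "hole_free E V s t \<Longrightarrow> E \<subseteq> E' \<Longrightarrow> hole_free E' V s t"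
  unfolding hole_free_def by (intro allI impI) (meson subsetD)

lemma two_connected_mono:
  assumes "two_connected E V" "E \<subseteq> E'"
  shows "two_connected E' V"
  unfolding two_connected_def
proof (intro conjI allI impI)
  show "2 < card V" using assms(1) by (simp add: two_connected_def)
  fix X A B
  assume "X \<union> A \<union> B = V \<and> card X < 2 \<and> X \<inter> A = {} \<and> X \<inter> B = {} \<and> A \<inter> B = {} \<and> A \<noteq> {} \<and> B \<noteq> {}"
  then obtain a b where "a \<in> A" "b \<in> B" "(a, b) \<in> E"
    by (elim conjE) (rule two_connected_cut[OF assms(1)])
  then show "\<exists>a\<in>A. \<exists>b\<in>B. (a, b) \<in> E'" using assms(2) by blast
qed

text \<open>With \<open>k = s + t - 1\<close>, the last hypothesis is the degree-sum bound
  \<open>2 * k - 1\<close> with the one moved to the other side.\<close>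

lemma ham_cycle_exists:
  assumes "finite V" "sym E" "irrefl E" "E \<subseteq> V \<times> V" "two_connected E V"
    and "0 < s" "0 < t" "hole_free E V s t"
    and "\<And>x y. x \<in> V \<Longrightarrow> y \<in> V \<Longrightarrow> x \<noteq> y \<Longrightarrow> (x, y) \<notin> E
      \<Longrightarrow> 2 * (s + t - 1) \<le> card (E `` {x}) + card (E `` {y}) + 1"
  shows "\<exists>xs. ham_cycle E V xs"
  using assms
proof (induction "card (V \<times> V - E)" arbitrary: E rule: less_induct)
  case less
  note sym = less.prems(2) and conn = less.prems(5) and deg = less.prems(9)
  define H where "H = {x \<in> V. s + t \<le> card (E `` {x}) + 1}"
  show ?case
  proof (cases "\<exists>u\<in>H. \<exists>v\<in>H. u \<noteq> v \<and> (u, v) \<notin> E")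
    case True
    then obtain u v where uv: "u \<in> H" "v \<in> H" "u \<noteq> v" "(u, v) \<notin> E" by blast
    \<comment> \<open>Only edges inside \<open>H\<close> are added, so the ends of the resulting
      path have the degrees that \<open>ham_path_closes\<close> requires. Both orientations keep the
      relation symmetric.\<close>
    let ?E = "insert (u, v) (insert (v, u) E)"
    have uvV: "u \<in> V" "v \<in> V" using uv by (auto simp: H_def)
    have fin: "finite (?E `` {x})" for x
      by (rule finite_subset[OF _ \<open>finite V\<close>]) (use less.prems(4) uvV in auto)
    have mono: "card (E `` {x}) \<le> card (?E `` {x})" for x
      by (rule card_mono[OF fin]) auto
    have "\<exists>xs. ham_cycle ?E V xs"
    proof (rule less.hyps)
      show "card (V \<times> V - ?E) < card (V \<times> V - E)"
        using uv uvV \<open>finite V\<close> by (intro psubset_card_mono) auto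
      show "sym ?E" using sym by (auto simp: sym_def)
      show "irrefl ?E" using less.prems(3) uv by (auto simp: irrefl_def)
      show "?E \<subseteq> V \<times> V" using less.prems(4) uvV by auto
      show "two_connected ?E V" by (rule two_connected_mono[OF conn]) auto
      show "hole_free ?E V s t" by (rule hole_free_mono[OF less.prems(8)]) auto
      fix x y assume "x \<in> V" "y \<in> V" "x \<noteq> y" "(x, y) \<notin> ?E"
      then have "2 * (s + t - 1) \<le> card (E `` {x}) + card (E `` {y}) + 1" using deg by blast
      then show "2 * (s + t - 1) \<le> card (?E `` {x}) + card (?E `` {y}) + 1"
        using mono[of x] mono[of y] by linarith
    qed (use less.prems in auto)
    then consider "\<exists>ys. ham_cycle E V ys" | ys where "ham_path E V ys" "hd ys = u" "last ys = v"
      using ham_cycle_remove_edge[OF _ uv(3) sym] by blast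
    then show ?thesis
    proof cases
      case 2
      then show ?thesis
        using less.prems uv by (intro ham_path_closes[of V E ys s t]) (auto simp: H_def)
    qed
  next
    case False
    show ?thesis
    proof (rule ham_cycle_two_cliques[OF conn sym \<open>finite V\<close>, of "V - H" H])
      fix x y assume xy: "x \<in> V - H" "y \<in> V - H" "x \<noteq> y"
      show "(x, y) \<in> E"
      proof (rule ccontr)
        assume "(x, y) \<notin> E"
        then show False using deg[of x y] xy by (auto simp: H_def)
      qed
    qed (use False in \<open>auto simp: H_def\<close>)
  qed
qed

section \<open>Translation to digraphs\<close>

lemma (in pair_graph) degree_eq_card_neighbours: "degree G x = card (parcs G `` {x})"
proof -
  have "out_arcs (with_proj G) x = Pair x ` (parcs G `` {x})"
    by (auto simp: out_arcs_def)
  then show ?thesis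
    by (simp add: degree_def out_degree_def card_image inj_on_def)
qed

text \<open>Large enough sets contain subsets of the exact sizes, and a missing edge is inherited by
  subsets.\<close>

lemma (in pair_graph) hole_free_iff:
  "hole_free (parcs G) (pverts G) s t \<longleftrightarrow> \<not> (\<exists>S T. bipartite_hole G s t S T)"
proof
  assume "hole_free (parcs G) (pverts G) s t"
  then show "\<not> (\<exists>S T. bipartite_hole G s t S T)"
    unfolding hole_free_def bipartite_hole_def by (metis order_refl)
next
  assume no: "\<not> (\<exists>S T. bipartite_hole G s t S T)"
  show "hole_free (parcs G) (pverts G) s t"
    unfolding hole_free_def
  proof (intro allI impI)
    fix S T assume ST: "S \<subseteq> pverts G \<and> T \<subseteq> pverts G \<and> S \<inter> T = {} \<and> s \<le> card S \<and> t \<le> card T"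
    obtain S' T' where "S' \<subseteq> S" "card S' = s" "T' \<subseteq> T" "card T' = t"
      using ST obtain_subset_with_card_n by metis
    then show "\<exists>x\<in>S. \<exists>y\<in>T. (x, y) \<in> parcs G"
      using no ST unfolding bipartite_hole_def by (smt (verit) disjoint_iff subset_iff)
  qed
qed

text \<open>A walk from \<open>A\<close> to \<open>B\<close> that avoids \<open>X\<close> must at
  some step pass directly from \<open>A\<close> to \<open>B\<close>.\<close>

lemma (in pair_graph) two_connected_if_k_connected:
  assumes "k_connected 2 G"
  shows "two_connected (parcs G) (pverts G)"
  unfolding two_connected_def
proof (intro conjI allI impI)
  show "2 < card (pverts G)" using assms by (simp add: k_connected_def)
  fix X A B
  assume *: "X \<union> A \<union> B = pverts G \<and> card X < 2 \<and> X \<inter> A = {} \<and> X \<inter> B = {} \<and> A \<inter> B = {} \<and> A \<noteq> {} \<and> B \<noteq> {}"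
  then obtain a b where ab: "a \<in> A" "b \<in> B" by blast
  \<comment> \<open>\<open>connected\<close> refers to the symmetric closure; as \<open>G\<close> is
    symmetric, this closure contains only arcs of \<open>G\<close>.\<close>
  let ?H = "mk_symmetric (with_proj G \<restriction> (pverts G - X))"
  have "connected (with_proj G \<restriction> (pverts G - X))"
    using assms * unfolding k_connected_def by (elim conjE allE[of _ X] impE) auto
  moreover have "a \<in> pverts G - X" "b \<in> pverts G - X" using * ab by blast+
  ultimately have "a \<rightarrow>\<^sup>*\<^bsub>with_proj ?H\<^esub> b"
    unfolding connected_def strongly_connected_def by simp
  then have "(a, b) \<in> rtrancl_on (pverts G - X) (parcs ?H)"
    unfolding reachable_def by simp
  then have "b \<in> A \<or> (\<exists>x\<in>A. \<exists>y\<in>B. (x, y) \<in> parcs G)"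
  proof (induction rule: rtrancl_on_induct)
    case base
    then show ?case using ab by blast
  next
    case (step y z)
    have "(y, z) \<in> parcs G"
      using step.hyps(2) arcs_symmetric by (auto simp: parcs_mk_symmetric)
    then show ?case using step * by blast
  qed
  then show "\<exists>x\<in>A. \<exists>y\<in>B. (x, y) \<in> parcs G" using * ab by blast
qed

text \<open>The \<open>zip\<close> pairs each vertex with its successor, \<open>v\<close> following
  the last. Keeping \<open>v\<close> independent of \<open>hd xs\<close> lets the induction pass to
  the tail; the closed walk is the instance \<open>v = hd xs\<close>.\<close>

lemma (in pair_graph) awalk_of_adj_path:
  assumes "adj_path (parcs G) xs" "xs \<noteq> []" "(last xs, v) \<in> parcs G"
  shows "awalk (hd xs) (zip xs (tl xs @ [v])) v"
    and "awalk_verts (hd xs) (zip xs (tl xs @ [v])) = xs @ [v]"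
  using assms
proof (induction xs rule: induct_list012)
  case (2 x)
  case 1 then show ?case by (auto simp: awalk_def in_arcsD1)
  case 2 then show ?case by simp
next
  case (3 x y zs)
  case 1 then show ?case using "3.IH"(3) by (auto simp: awalk_def in_arcsD1)
  case 2 then show ?case using "3.IH"(4) by auto
qed auto

lemma (in pair_graph) hamiltonian_if_ham_cycle:
  assumes "ham_cycle (parcs G) (pverts G) xs"
  shows "hamiltonian G"
proof -
  let ?p = "zip xs (tl xs @ [hd xs])"
  have xs: "distinct xs" "set xs = pverts G" "adj_path (parcs G) xs" "3 \<le> length xs"
    "(last xs, hd xs) \<in> parcs G" "xs \<noteq> []"
    using assms by (auto simp: ham_cycle_def ham_path_def)
  have walk: "awalk (hd xs) ?p (hd xs)" "awalk_verts (hd xs) ?p = xs @ [hd xs]"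
    using awalk_of_adj_path[OF xs(3,6,5)] by auto
  have len: "3 \<le> length ?p" using xs(4) by simp
  \<comment> \<open>The start vertex occurs at both ends of the closed walk, so \<open>cycle\<close>
    asks for distinctness only after the first entry.\<close>
  have "distinct (tl (xs @ [hd xs]))" using xs(1,6) by (cases xs) auto
  then have "cycle ?p"
    unfolding cycle_def using walk len by (intro exI[of _ "hd xs"]) auto
  moreover have "set (awalk_verts (hd xs) ?p) = pverts G"
    unfolding walk(2) using xs(2) hd_in_set[OF xs(6)] by auto
  ultimately show ?thesis
    unfolding hamiltonian_def using walk len by (metis awalk_verts_with_proj_eq)
qed

theorem theorem1p4:
  fixes G :: "'a pair_pre_digraph"
  assumes "pair_graph G"
    and "k_connected 2 G"
    and "sigma2 G \<ge> enat (2 * bipartite_hole_number G - 1)"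
  shows "hamiltonian G"
proof -
  interpret pair_graph G by fact
  obtain s t where st: "0 < s" "0 < t" "s + t = bipartite_hole_number G + 1"
    "\<not> (\<exists>S T. bipartite_hole G s t S T)"
    using bipartite_hole_number_attained[OF pair_finite_verts] by blast
  have "\<exists>xs. ham_cycle (parcs G) (pverts G) xs"
  proof (rule ham_cycle_exists)
    show "sym (parcs G)" using arcs_symmetric by (auto simp: sym_def)
    show "irrefl (parcs G)" using no_loops' by (auto simp: irrefl_def)
    show "parcs G \<subseteq> pverts G \<times> pverts G" using in_arcsD1 in_arcsD2 by auto
    show "hole_free (parcs G) (pverts G) s t" using st(4) hole_free_iff by blast
    fix x y assume "x \<in> pverts G" "y \<in> pverts G" "x \<noteq> y" "(x, y) \<notin> parcs G"
    then have "sigma2 G \<le> enat (degree G x + degree G y)"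
      unfolding sigma2_def by (intro Inf_lower) blast
    then have "2 * bipartite_hole_number G - 1 \<le> degree G x + degree G y"
      using assms(3) order_trans by fastforce
    \<comment> \<open>Here \<open>s + t - 1\<close> is the bipartite-hole-number, by the choice of
      \<open>s\<close> and \<open>t\<close>.\<close>
    then show "2 * (s + t - 1) \<le> card (parcs G `` {x}) + card (parcs G `` {y}) + 1"
      using st(3) by (simp add: degree_eq_card_neighbours)
  qed (use st pair_finite_verts two_connected_if_k_connected[OF assms(2)] in auto)
  then show ?thesis using hamiltonian_if_ham_cycle by blast
qed

end
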